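(* Let $G=(V,E)$ be a finite, simple, connected graph with Bakry Emery curvature $K(x)\geq K>0$ at every vertex $x$, and assume $\operatorname{diam}_{\operatorname{eff}}(G)=\frac{\max_v\operatorname{Deg}(v)}{K}$. Then $G$ is a hypercube.
   Context: $d$ is the combinatorial distance, $\operatorname{Deg}$ the degree, $\operatorname{diam}_{\operatorname{eff}}(G)=\frac{1}{|V|^2}\sum_{x,y}d(x,y)$. Laplacian $\Delta f(x)=\sum_{y\sim x}(f(y)-f(x))$. Define $\Gamma_0(f,g)=fg$ and $2\Gamma_{i+1}(f,g)=\Delta\Gamma_i(f,g)-\Gamma_i(f,\Delta g)-\Gamma_i(\Delta f,g)$; write $\Gamma=\Gamma_1$, $\Gamma_i f=\Gamma_i(f,f)$. The Bakry Emery curvature at $x$ is $K(x)=\inf\{\Gamma_2 f(x): \Gamma f(x)=1\}$. Hypercube $Q_n$: binary strings of length $n$, adjacent iff differing in exactly one coordinate. *)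

theory Defs
  imports "HOL-Analysis.Analysis"
begin

text \<open>A finite simple graph is given by a finite vertex set V and a symmetric,
irreflexive edge relation E; only edges between vertices of V are used.\<close>

definition adj :: "'a set \<Rightarrow> ('a \<Rightarrow> 'a \<Rightarrow> bool) \<Rightarrow> 'a \<Rightarrow> 'a \<Rightarrow> bool" where
  "adj V E x y \<longleftrightarrow> x \<in> V \<and> y \<in> V \<and> E x y"

definition nbrs :: "'a set \<Rightarrow> ('a \<Rightarrow> 'a \<Rightarrow> bool) \<Rightarrow> 'a \<Rightarrow> 'a set" where
  "nbrs V E x = {y \<in> V. E x y}"

definition deg :: "'a set \<Rightarrow> ('a \<Rightarrow> 'a \<Rightarrow> bool) \<Rightarrow> 'a \<Rightarrow> nat" where
  "deg V E x = card (nbrs V E x)"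

definition max_deg :: "'a set \<Rightarrow> ('a \<Rightarrow> 'a \<Rightarrow> bool) \<Rightarrow> nat" where
  "max_deg V E = Max (deg V E ` V)"

definition simple_graph :: "'a set \<Rightarrow> ('a \<Rightarrow> 'a \<Rightarrow> bool) \<Rightarrow> bool" where
  "simple_graph V E \<longleftrightarrow> finite V \<and> (\<forall>x y. E x y \<longrightarrow> E y x) \<and> (\<forall>x. \<not> E x x)"

definition connected_graph :: "'a set \<Rightarrow> ('a \<Rightarrow> 'a \<Rightarrow> bool) \<Rightarrow> bool" where
  "connected_graph V E \<longleftrightarrow> V \<noteq> {} \<and> (\<forall>x\<in>V. \<forall>y\<in>V. (adj V E)\<^sup>*\<^sup>* x y)"

definition gdist :: "'a set \<Rightarrow> ('a \<Rightarrow> 'a \<Rightarrow> bool) \<Rightarrow> 'a \<Rightarrow> 'a \<Rightarrow> nat" where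
  "gdist V E x y = (LEAST n. (adj V E ^^ n) x y)"

definition diam_eff :: "'a set \<Rightarrow> ('a \<Rightarrow> 'a \<Rightarrow> bool) \<Rightarrow> real" where
  "diam_eff V E = (\<Sum>x\<in>V. \<Sum>y\<in>V. real (gdist V E x y)) / (real (card V))\<^sup>2"

definition laplacian :: "'a set \<Rightarrow> ('a \<Rightarrow> 'a \<Rightarrow> bool) \<Rightarrow> ('a \<Rightarrow> real) \<Rightarrow> 'a \<Rightarrow> real" where
  "laplacian V E f x = (\<Sum>y\<in>nbrs V E x. f y - f x)"

fun Gamma_i :: "'a set \<Rightarrow> ('a \<Rightarrow> 'a \<Rightarrow> bool) \<Rightarrow> nat \<Rightarrow> ('a \<Rightarrow> real) \<Rightarrow> ('a \<Rightarrow> real) \<Rightarrow> 'a \<Rightarrow> real" where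
  "Gamma_i V E 0 f g = (\<lambda>x. f x * g x)"
| "Gamma_i V E (Suc i) f g = (\<lambda>x.
     (laplacian V E (Gamma_i V E i f g) x
      - Gamma_i V E i f (laplacian V E g) x
      - Gamma_i V E i (laplacian V E f) g x) / 2)"

text \<open>Bakry--Emery curvature at x: infimum (in the extended reals, inf of the
empty set = +\<infinity>) of \<open>\<Gamma>\<^sub>2 f (x)\<close> over f with \<open>\<Gamma> f (x) = 1\<close>.\<close>
definition BE_curv :: "'a set \<Rightarrow> ('a \<Rightarrow> 'a \<Rightarrow> bool) \<Rightarrow> 'a \<Rightarrow> ereal" where
  "BE_curv V E x = Inf {ereal (Gamma_i V E 2 f f x) | f. Gamma_i V E 1 f f x = 1}"

definition hc_adj :: "nat \<Rightarrow> bool list \<Rightarrow> bool list \<Rightarrow> bool" where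
  "hc_adj n xs ys \<longleftrightarrow> card {i. i < n \<and> xs ! i \<noteq> ys ! i} = 1"

definition is_hypercube :: "'a set \<Rightarrow> ('a \<Rightarrow> 'a \<Rightarrow> bool) \<Rightarrow> bool" where
  "is_hypercube V E \<longleftrightarrow> (\<exists>n \<phi>. bij_betw \<phi> V {xs. length xs = n} \<and>
      (\<forall>x\<in>V. \<forall>y\<in>V. E x y \<longleftrightarrow> hc_adj n (\<phi> x) (\<phi> y)))"

end

theory Submission
  imports Defs
begin

text \<open>Let \<open>f = d(x, -)\<close>, let \<open>f\<^sub>t\<close> be its heat flow and let \<open>D\<close> be the maximal degree. The curvature
  bound makes \<open>w = exp (2Kt) \<Gamma>(f\<^sub>t)\<close> a subsolution of the heat equation, so \<open>w \<le> D/2\<close> and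
  \<open>\<bar>\<Delta> f\<^sub>t(x)\<bar> \<le> D exp (-Kt)\<close>. Integrating in time, the mean of \<open>f\<close> is at most \<open>D/K\<close>; if the effective
  diameter is \<open>D/K\<close>, equality holds for every \<open>x\<close>, so \<open>w(x) = D/2\<close> at all times. The strong maximum
  principle spreads this to all vertices, whence \<open>\<Gamma> f = D/2\<close> (the graph is \<open>D\<close>-regular and bipartite)
  and \<open>\<Gamma>\<^sub>2 f = K \<Gamma> f\<close> everywhere. As \<open>\<Gamma>\<^sub>2 - K \<Gamma>\<close> is positive semidefinite, also
  \<open>\<Gamma>\<^sub>2(f, g) = K \<Gamma>(f, g)\<close> for all \<open>g\<close>; taking for \<open>g\<close> the indicator of \<open>z\<close> at a vertex \<open>y\<close>
  neither equal nor adjacent to \<open>z\<close> gives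
  \<open>\<Sum>\<^sub>w (d(x,y) + d(x,z) - 2 d(x,w)) = 0\<close> over the common neighbours \<open>w\<close> of \<open>y\<close> and \<open>z\<close>.
  With \<open>x\<close> one of them this says that there are exactly two, so any two edges at a vertex span a
  square; for general \<open>x\<close> it says that opposite edges of a square split the vertices in the same
  way into those closer to one end and those closer to the other. Transporting splittings along
  paths, the \<open>D\<close> splittings at a base vertex are coordinates that each edge flips one at a time.\<close>

section \<open>One-variable calculus\<close>

text \<open>The quadratic has a minimum at 0, so its slope there vanishes.\<close>

lemma quadratic_nonneg_imp_linear_zero:
  fixes b c :: real
  assumes "\<And>s. 0 \<le> s * b + s\<^sup>2 * c"
  shows "b = 0"
proof (rule ccontr)
  assume b: "b \<noteq> 0"
  define m where "m = \<bar>c\<bar> + 1"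
  have m: "m > 0" "c < m" by (auto simp: m_def)
  \<comment> \<open>With \<open>m > c\<close> and \<open>m > 0\<close>, the point
    \<open>- (b / m)\<close> gives the value
    \<open>(b\<^sup>2 / m\<^sup>2) * (c - m) < 0\<close>.\<close>
  have "0 \<le> - (b / m) * b + (- (b / m))\<^sup>2 * c" by (rule assms)
  also have "\<dots> = (b\<^sup>2 / m\<^sup>2) * (c - m)"
    using m by (simp add: field_simps power2_eq_square)
  also have "\<dots> < 0" using m b by (intro mult_pos_neg) auto
  finally show False by simp
qed

text \<open>A nonzero derivative would move \<open>h\<close> immediately to the right of
  \<open>t\<close>. Only right increments are used, which covers \<open>t = 0\<close>.\<close>

lemma deriv_eq_0_of_constant:
  fixes h :: "real \<Rightarrow> real"
  assumes deriv: "(h has_real_derivative D) (at t)"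
    and c: "\<And>s. 0 \<le> s \<Longrightarrow> h s = c" and t: "0 \<le> t"
  shows "D = 0"
proof (rule ccontr)
  assume "D \<noteq> 0"
  then obtain \<delta> where "\<delta> > 0" "\<And>s. 0 < s \<Longrightarrow> s < \<delta> \<Longrightarrow> h (t + s) \<noteq> h t"
    using DERIV_pos_inc_right[OF deriv] DERIV_neg_dec_right[OF deriv]
    by (metis less_irrefl linorder_cases)
  from this(2)[of "\<delta> / 2"] this(1) show False using c t by simp
qed

section \<open>Finite connected graphs\<close>

locale finite_graph =
  fixes V :: "'a set" and E :: "'a \<Rightarrow> 'a \<Rightarrow> bool"
  assumes simple: "simple_graph V E" and conn: "connected_graph V E"
begin

abbreviation N where "N \<equiv> nbrs V E"
abbreviation L where "L \<equiv> laplacian V E"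
abbreviation d where "d \<equiv> gdist V E"
abbreviation \<Gamma> where "\<Gamma> \<equiv> Gamma_i V E (Suc 0)"
abbreviation \<Gamma>\<^sub>2 where "\<Gamma>\<^sub>2 \<equiv> Gamma_i V E 2"

lemma finV: "finite V" and sym: "E x y \<Longrightarrow> E y x" and irrefl: "\<not> E x x"
  using simple by (auto simp: simple_graph_def)

lemma finite_nbrs [simp]: "finite (N x)"
  using finV by (simp add: nbrs_def)

lemma nbrs_sym: "x \<in> V \<Longrightarrow> y \<in> N x \<Longrightarrow> x \<in> N y"
  using sym by (auto simp: nbrs_def)

lemma nbrs_in_V: "y \<in> N x \<Longrightarrow> y \<in> V"
  by (auto simp: nbrs_def)

lemma not_self_nbr: "x \<notin> N x"
  using irrefl by (auto simp: nbrs_def)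

lemma V_nonempty: "V \<noteq> {}"
  using conn by (simp add: connected_graph_def)

lemma nbrs_induct:
  assumes "x0 \<in> V" "x \<in> V" "P x0"
    and step: "\<And>x y. x \<in> V \<Longrightarrow> P x \<Longrightarrow> y \<in> N x \<Longrightarrow> P y"
  shows "P x"
proof -
  have "(adj V E)\<^sup>*\<^sup>* x0 x" using conn assms(1,2) by (auto simp: connected_graph_def)
  thus ?thesis
  proof induction
    case base thus ?case by fact
  next
    case (step y z)
    thus ?case using assms(4)[of y z] by (auto simp: adj_def nbrs_def)
  qed
qed

lemma adj_iff_nbrs: "adj V E x y \<longleftrightarrow> x \<in> V \<and> y \<in> N x"
  by (auto simp: adj_def nbrs_def)

subsection \<open>The graph distance\<close>

lemma dist_walk:
  assumes "x \<in> V" "y \<in> V"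
  shows "(adj V E ^^ d x y) x y"
proof -
  have "\<exists>n. (adj V E ^^ n) x y"
    using conn assms by (auto simp: connected_graph_def rtranclp_power)
  thus ?thesis unfolding gdist_def by (rule LeastI_ex)
qed

lemma dist_le: "(adj V E ^^ n) x y \<Longrightarrow> d x y \<le> n"
  unfolding gdist_def by (rule Least_le)

lemma dist_self [simp]: "d x x = 0"
  using dist_le[of 0 x x] by simp

lemma walk_sym: "(adj V E ^^ n) x y \<Longrightarrow> (adj V E ^^ n) y x"
proof (induction n arbitrary: y)
  case (Suc n)
  then obtain z where "(adj V E ^^ n) x z" "adj V E z y" by auto
  hence "(adj V E ^^ n) z x" "adj V E y z" using Suc.IH sym by (blast, auto simp: adj_def)
  thus ?case by (meson relpowp_Suc_I2)
qed auto

lemma dist_sym: "d x y = d y x"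
proof -
  have "(adj V E ^^ n) x y \<longleftrightarrow> (adj V E ^^ n) y x" for n using walk_sym by blast
  thus ?thesis by (simp add: gdist_def)
qed

lemma dist_eq_0: "x \<in> V \<Longrightarrow> y \<in> V \<Longrightarrow> d x y = 0 \<longleftrightarrow> x = y"
  using dist_walk[of x y] by auto

lemma dist_nbr_le:
  assumes "x \<in> V" "y \<in> V" "z \<in> N y"
  shows "d x z \<le> Suc (d x y)"
proof -
  have "adj V E y z" using assms by (simp add: adj_iff_nbrs)
  thus ?thesis using dist_walk[OF assms(1,2)] by (intro dist_le) auto
qed

lemma dist_nbr:
  assumes "x \<in> V" "y \<in> V" "z \<in> N y"
  shows "\<bar>real (d x z) - real (d x y)\<bar> \<le> 1"
  using dist_nbr_le[OF assms] dist_nbr_le[of x z y] assms nbrs_in_V nbrs_sym by fastforce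

lemma dist_eq_1:
  assumes "x \<in> V" "y \<in> V"
  shows "d x y = 1 \<longleftrightarrow> y \<in> N x"
proof
  assume "d x y = 1"
  thus "y \<in> N x" using dist_walk[OF assms] by (auto simp: adj_iff_nbrs)
next
  assume y: "y \<in> N x"
  hence "d x y \<le> 1" using dist_nbr_le[of x x y] assms by simp
  moreover have "d x y \<noteq> 0" using dist_eq_0 assms y not_self_nbr by metis
  ultimately show "d x y = 1" by simp
qed

lemma geodesic_step:
  assumes "x \<in> V" "y \<in> V" "x \<noteq> y"
  obtains z where "z \<in> N x" "Suc (d z y) = d x y"
proof -
  obtain n where n: "d x y = Suc n" using dist_eq_0 assms by (metis not0_implies_Suc)
  hence "(adj V E ^^ Suc n) x y" using dist_walk[OF assms(1,2)] by simp
  then obtain z where z: "adj V E x z" "(adj V E ^^ n) z y" by (meson relpowp_Suc_D2)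
  hence "z \<in> N x" "d z y \<le> n" by (auto simp: adj_iff_nbrs dist_le)
  moreover have "d y x \<le> Suc (d y z)"
    using dist_nbr_le[of y z x] nbrs_sym nbrs_in_V \<open>z \<in> N x\<close> assms by blast
  ultimately show ?thesis using that n dist_sym by (metis Suc_le_mono le_antisym)
qed

subsection \<open>Gamma calculus\<close>

text \<open>The product rule on a graph leaves exactly the product of the two increments as its
  defect.\<close>

lemma Gamma1: "\<Gamma> f g x = (\<Sum>y\<in>N x. (f y - f x) * (g y - g x)) / 2"
proof -
  have "2 * \<Gamma> f g x = (\<Sum>y\<in>N x. (f y * g y - f x * g x) - f x * (g y - g x) - (f y - f x) * g x)"
    unfolding Gamma_i.simps laplacian_def sum_subtractf sum_distrib_left[symmetric]
      sum_distrib_right[symmetric] by simp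
  also have "\<dots> = (\<Sum>y\<in>N x. (f y - f x) * (g y - g x))"
    by (intro sum.cong refl) (simp add: algebra_simps)
  finally show ?thesis by simp
qed

lemma Gamma2: "\<Gamma>\<^sub>2 f g x = (L (\<Gamma> f g) x - \<Gamma> f (L g) x - \<Gamma> (L f) g x) / 2"
  by (simp only: numeral_2_eq_2 Gamma_i.simps)

declare Gamma_i.simps [simp del]

lemma Gamma1_commute: "\<Gamma> f g x = \<Gamma> g f x"
  by (simp add: Gamma1 mult.commute)

lemma Gamma2_commute: "\<Gamma>\<^sub>2 f g x = \<Gamma>\<^sub>2 g f x"
proof -
  have "\<Gamma> f g = \<Gamma> g f" by (intro ext Gamma1_commute)
  thus ?thesis
    using Gamma1_commute[of f "L g" x] Gamma1_commute[of "L f" g x] by (simp add: Gamma2)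
qed

lemma Gamma1_lincomb_left:
  "\<Gamma> (\<lambda>y. a * f y + b * g y) h = (\<lambda>x. a * \<Gamma> f h x + b * \<Gamma> g h x)"
proof
  fix x
  have "(\<Sum>y\<in>N x. ((a * f y + b * g y) - (a * f x + b * g x)) * (h y - h x))
      = (\<Sum>y\<in>N x. a * ((f y - f x) * (h y - h x)) + b * ((g y - g x) * (h y - h x)))"
    by (intro sum.cong refl) (simp add: algebra_simps)
  thus "\<Gamma> (\<lambda>y. a * f y + b * g y) h x = a * \<Gamma> f h x + b * \<Gamma> g h x"
    by (simp add: Gamma1 sum.distrib sum_distrib_left[symmetric] add_divide_distrib)
qed

lemma laplacian_lincomb:
  "L (\<lambda>y. a * f y + b * g y) = (\<lambda>x. a * L f x + b * L g x)"
  by (rule ext) (simp add: laplacian_def sum_distrib_left sum.distrib[symmetric] algebra_simps)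

lemma Gamma2_lincomb_left:
  "\<Gamma>\<^sub>2 (\<lambda>y. a * f y + b * g y) h x = a * \<Gamma>\<^sub>2 f h x + b * \<Gamma>\<^sub>2 g h x"
  unfolding Gamma2 Gamma1_lincomb_left laplacian_lincomb by (simp add: field_simps)

lemma Gamma1_quadratic:
  "\<Gamma> (\<lambda>y. a * f y + b * g y) (\<lambda>y. a * f y + b * g y) x
     = a\<^sup>2 * \<Gamma> f f x + 2 * a * b * \<Gamma> f g x + b\<^sup>2 * \<Gamma> g g x"
  by (simp add: Gamma1_lincomb_left Gamma1_commute[of f "\<lambda>y. a * f y + b * g y"]
      Gamma1_commute[of g "\<lambda>y. a * f y + b * g y"] Gamma1_commute[of g f]
      power2_eq_square algebra_simps)

lemma Gamma2_quadratic:
  "\<Gamma>\<^sub>2 (\<lambda>y. a * f y + b * g y) (\<lambda>y. a * f y + b * g y) x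
     = a\<^sup>2 * \<Gamma>\<^sub>2 f f x + 2 * a * b * \<Gamma>\<^sub>2 f g x + b\<^sup>2 * \<Gamma>\<^sub>2 g g x"
  by (simp add: Gamma2_lincomb_left Gamma2_commute[of f "\<lambda>y. a * f y + b * g y"]
      Gamma2_commute[of g "\<lambda>y. a * f y + b * g y"] Gamma2_commute[of g f]
      power2_eq_square algebra_simps)

lemma Gamma1_nonneg: "0 \<le> \<Gamma> f f x"
  by (simp add: Gamma1 sum_nonneg)

text \<open>By homogeneity, the infimum over normalised functions becomes the inequality
  CD(K,\<infinity>) for all functions.\<close>

lemma curvature_dimension:
  assumes curv: "ereal K \<le> BE_curv V E x"
  shows "K * \<Gamma> f f x \<le> \<Gamma>\<^sub>2 f f x"
proof (cases "\<Gamma> f f x = 0")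
  \<comment> \<open>No normalisation is possible: \<open>f\<close> is constant around
    \<open>x\<close>, so the mixed terms vanish. What remains is half the Laplacian of
    \<open>\<Gamma> f f\<close> at one of its zeros, hence nonnegative.\<close>
  case True
  hence "\<forall>y\<in>N x. (f y - f x) * (f y - f x) = 0"
    by (simp add: Gamma1 sum_nonneg_eq_0_iff)
  hence "\<Gamma> f (L f) x = 0" "\<Gamma> (L f) f x = 0" by (simp_all add: Gamma1)
  moreover have "0 \<le> L (\<Gamma> f f) x"
    using True by (simp add: laplacian_def sum_nonneg Gamma1_nonneg)
  ultimately show ?thesis using True by (simp add: Gamma2)
next
  case False
  define c where "c = \<Gamma> f f x"
  have c: "c > 0" using False Gamma1_nonneg[of f x] by (simp add: c_def)
  \<comment> \<open>The zero summand brings the rescaling into the shape of the quadratic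
    expansions.\<close>
  define g where "g = (\<lambda>y. (1 / sqrt c) * f y + 0 * f y)"
  have "\<Gamma> g g x = 1" unfolding g_def Gamma1_quadratic
    using c by (simp add: c_def[symmetric] power_divide)
  hence "BE_curv V E x \<le> ereal (\<Gamma>\<^sub>2 g g x)"
    unfolding BE_curv_def by (intro Inf_lower) auto
  hence "K \<le> \<Gamma>\<^sub>2 g g x" using curv order_trans by fastforce
  also have "\<dots> = \<Gamma>\<^sub>2 f f x / c"
    unfolding g_def Gamma2_quadratic using c by (simp add: power_divide)
  finally show ?thesis using c by (simp add: c_def[symmetric] field_simps)
qed

text \<open>The two orientations of each edge cancel; this makes the heat flow preserve the
  mean.\<close>

lemma sum_laplacian: "(\<Sum>x\<in>V. L f x) = 0"
proof -
  have e: "(\<Sum>x\<in>V. \<Sum>y\<in>N x. g x y) = (\<Sum>x\<in>V. \<Sum>y\<in>V. if E x y then g x y else 0)" for g :: "'a \<Rightarrow> 'a \<Rightarrow> real"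
    unfolding nbrs_def by (rule sum.cong[OF refl], rule sum.inter_filter[OF finV])
  have "(\<Sum>x\<in>V. \<Sum>y\<in>N x. f y) = (\<Sum>x\<in>V. \<Sum>y\<in>V. if E x y then f y else 0)" by (rule e)
  also have "\<dots> = (\<Sum>y\<in>V. \<Sum>x\<in>V. if E x y then f y else 0)" by (rule sum.swap)
  also have "\<dots> = (\<Sum>y\<in>V. \<Sum>x\<in>V. if E y x then f y else 0)"
    using sym by (intro sum.cong refl) auto
  also have "\<dots> = (\<Sum>y\<in>V. \<Sum>x\<in>N y. f y)" by (rule e[symmetric])
  finally show ?thesis by (simp only: laplacian_def sum_subtractf)
qed

text \<open>Cauchy-Schwarz against the constant 1 on the neighbours.\<close>

lemma laplacian_sq_le: "(L f x)\<^sup>2 \<le> real (deg V E x) * (2 * \<Gamma> f f x)"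
proof -
  have "(\<Sum>y\<in>N x. (f y - f x) * 1)\<^sup>2 \<le> (\<Sum>y\<in>N x. (f y - f x)\<^sup>2) * (\<Sum>y\<in>N x. 1\<^sup>2)"
    by (rule Cauchy_Schwarz_ineq_sum)
  thus ?thesis by (simp add: laplacian_def Gamma1 deg_def power2_eq_square mult.commute)
qed

lemma deg_le_max_deg: "x \<in> V \<Longrightarrow> deg V E x \<le> max_deg V E"
  unfolding max_deg_def using finV by (intro Max_ge) auto

subsection \<open>The heat semigroup\<close>

text \<open>The exponential series of \<open>t\<close> times the Laplacian, written as a power
  series in \<open>t\<close> so that it can be differentiated termwise.\<close>

definition heat :: "('a \<Rightarrow> real) \<Rightarrow> real \<Rightarrow> 'a \<Rightarrow> real" where
  "heat f t x = (\<Sum>n. ((L ^^ n) f x / fact n) * t ^ n)"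

lemma laplacian_iterate_bound:
  assumes "\<And>y. y \<in> V \<Longrightarrow> \<bar>f y\<bar> \<le> B" "x \<in> V"
  shows "\<bar>(L ^^ n) f x\<bar> \<le> (2 * real (card V)) ^ n * B"
  using assms(2)
proof (induction n arbitrary: x)
  case (Suc n)
  let ?c = "(2 * real (card V)) ^ n * B"
  have B: "0 \<le> ?c" using Suc.IH[OF Suc.prems] by linarith
  have "\<bar>(L ^^ Suc n) f x\<bar> \<le> (\<Sum>y\<in>N x. \<bar>(L ^^ n) f y - (L ^^ n) f x\<bar>)"
    unfolding funpow.simps comp_def laplacian_def by (rule sum_abs)
  also have "\<dots> \<le> (\<Sum>y\<in>N x. 2 * ?c)"
  proof (rule sum_mono)
    fix y assume "y \<in> N x"
    hence "\<bar>(L ^^ n) f y\<bar> \<le> ?c" "\<bar>(L ^^ n) f x\<bar> \<le> ?c"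
      using Suc.IH Suc.prems nbrs_in_V by blast+
    thus "\<bar>(L ^^ n) f y - (L ^^ n) f x\<bar> \<le> 2 * ?c" by linarith
  qed
  also have "\<dots> = real (card (N x)) * (2 * ?c)" by simp
  also have "\<dots> \<le> real (card V) * (2 * ?c)"
    using B finV by (intro mult_right_mono of_nat_mono card_mono) (auto simp: nbrs_def)
  finally show ?case by (simp add: mult_ac)
qed (use assms in auto)

lemma summable_heat:
  assumes "x \<in> V"
  shows "summable (\<lambda>n. ((L ^^ n) f x / fact n) * t ^ n)"
proof (rule summable_comparison_test')
  define B where "B = (\<Sum>y\<in>V. \<bar>f y\<bar>)"
  let ?a = "2 * real (card V) * \<bar>t\<bar>"
  have B: "\<bar>f y\<bar> \<le> B" if "y \<in> V" for y
    unfolding B_def using that finV by (intro member_le_sum) auto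
  show "summable (\<lambda>n. B * (inverse (fact n) * ?a ^ n))"
    by (intro summable_mult summable_exp)
  fix n
  have "\<bar>(L ^^ n) f x\<bar> * \<bar>t\<bar> ^ n \<le> (2 * real (card V)) ^ n * B * \<bar>t\<bar> ^ n"
    by (intro mult_right_mono laplacian_iterate_bound B assms) auto
  hence "\<bar>(L ^^ n) f x\<bar> * \<bar>t\<bar> ^ n / fact n \<le> (2 * real (card V)) ^ n * B * \<bar>t\<bar> ^ n / fact n"
    by (rule divide_right_mono) simp
  thus "norm (((L ^^ n) f x / fact n) * t ^ n) \<le> B * (inverse (fact n) * ?a ^ n)"
    by (simp add: abs_mult power_abs power_mult_distrib divide_inverse mult_ac)
qed

lemma heat_0 [simp]: "heat f 0 = f"
  by (rule ext) (simp add: heat_def powser_zero del: times_divide_eq_left)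

lemma heat_deriv:
  assumes x: "x \<in> V"
  shows "((\<lambda>t. heat f t x) has_real_derivative L (heat f t) x) (at t)"
proof -
  define c where "c = (\<lambda>y n. (L ^^ n) f y / fact n)"
  have s: "summable (\<lambda>n. c y n * s ^ n)" if "y \<in> V" for y s
    unfolding c_def by (rule summable_heat[OF that])
  have h: "heat f s y = (\<Sum>n. c y n * s ^ n)" for s y by (simp add: heat_def c_def)
  \<comment> \<open>The factor \<open>n + 1\<close> from differentiation cancels against the
    factorial, leaving the Laplacian of the \<open>n\<close>-th coefficient.\<close>
  have dc: "diffs (c x) n = (\<Sum>y\<in>N x. c y n - c x n)" for n
  proof -
    have "diffs (c x) n = L ((L ^^ n) f) x / fact n"
      by (simp add: diffs_def c_def del: of_nat_Suc)
    thus ?thesis by (simp add: laplacian_def c_def sum_divide_distrib diff_divide_distrib)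
  qed
  have "(\<Sum>n. diffs (c x) n * t ^ n) = (\<Sum>n. \<Sum>y\<in>N x. c y n * t ^ n - c x n * t ^ n)"
    by (simp add: dc sum_distrib_right left_diff_distrib)
  also have "\<dots> = (\<Sum>y\<in>N x. \<Sum>n. c y n * t ^ n - c x n * t ^ n)"
    by (intro suminf_sum summable_diff s x) (rule nbrs_in_V)
  also have "\<dots> = L (heat f t) x"
    unfolding laplacian_def h
    by (intro sum.cong refl suminf_diff[symmetric] s x) (rule nbrs_in_V)
  finally show ?thesis
    using termdiffs_strong_converges_everywhere[of "c x" t] s[OF x] by (simp add: h)
qed

lemma Gamma_heat_deriv:
  assumes "x \<in> V"
  shows "((\<lambda>t. \<Gamma> (heat f t) (heat f t) x) has_real_derivative
           2 * \<Gamma> (heat f t) (L (heat f t)) x) (at t)"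
proof -
  have "((\<lambda>t. \<Gamma> (heat f t) (heat f t) x) has_real_derivative
      (\<Sum>y\<in>N x. 2 * ((heat f t y - heat f t x) * (L (heat f t) y - L (heat f t) x))) / 2) (at t)"
    unfolding Gamma1
    by (auto intro!: derivative_eq_intros heat_deriv assms nbrs_in_V sum.cong simp: algebra_simps)
  thus ?thesis by (simp add: Gamma1 sum_distrib_left[symmetric])
qed

lemma sum_heat: "(\<Sum>x\<in>V. heat f t x) = (\<Sum>x\<in>V. f x)"
proof -
  have "((\<lambda>t. \<Sum>x\<in>V. heat f t x) has_real_derivative (\<Sum>x\<in>V. L (heat f t) x)) (at t)" for t
    by (intro DERIV_sum heat_deriv)
  hence "((\<lambda>t. \<Sum>x\<in>V. heat f t x) has_real_derivative 0) (at t)" for t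
    by (simp only: sum_laplacian)
  from DERIV_isconst_all[of "\<lambda>t. \<Sum>x\<in>V. heat f t x" t 0] this show ?thesis by simp
qed

section \<open>Maximum principle and gradient estimate\<close>

lemma parabolic_maximum_principle:
  assumes deriv: "\<And>x t. x \<in> V \<Longrightarrow> 0 \<le> t \<Longrightarrow> (w x has_real_derivative w' x t) (at t)"
    and le: "\<And>x t. x \<in> V \<Longrightarrow> 0 \<le> t \<Longrightarrow> w' x t \<le> L (\<lambda>y. w y t) x"
    and init: "\<And>x. x \<in> V \<Longrightarrow> w x 0 \<le> c"
    and x: "x \<in> V" and T: "0 \<le> T"
  shows "w x T \<le> c"
proof -
  have "w x T - \<epsilon> * T \<le> c" if \<epsilon>: "\<epsilon> > 0" for \<epsilon>
  proof -
    \<comment> \<open>The tilt makes the time derivative strictly negative at a space-time maximum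
      with positive time, so slightly earlier values would be larger.\<close>
    define u where "u = (\<lambda>y t. w y t - \<epsilon> * t)"
    have "\<exists>t\<in>{0..T}. \<forall>s\<in>{0..T}. u y s \<le> u y t" if "y \<in> V" for y
    proof (rule continuous_attains_sup)
      have "continuous_on {0..T} (w y)"
        by (rule DERIV_continuous_on[of _ _ "w' y"], rule has_field_derivative_at_within,
            rule deriv[OF that]) simp
      thus "continuous_on {0..T} (u y)" unfolding u_def by (intro continuous_intros)
    qed (use T in auto)
    then obtain m where m: "\<And>y. y \<in> V \<Longrightarrow> m y \<in> {0..T}"
        "\<And>y s. y \<in> V \<Longrightarrow> s \<in> {0..T} \<Longrightarrow> u y s \<le> u y (m y)"
      by metis
    obtain z where z: "z \<in> V" "\<And>y. y \<in> V \<Longrightarrow> u y (m y) \<le> u z (m z)"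
    proof -
      let ?S = "(\<lambda>y. u y (m y)) ` V"
      have "finite ?S" "?S \<noteq> {}" using finV V_nonempty by auto
      hence "Max ?S \<in> ?S" and "\<And>a. a \<in> ?S \<Longrightarrow> a \<le> Max ?S" by auto
      then obtain z where "z \<in> V" "Max ?S = u z (m z)" "\<And>y. y \<in> V \<Longrightarrow> u y (m y) \<le> Max ?S"
        by blast
      thus ?thesis using that by simp
    qed
    have max: "u y s \<le> u z (m z)" if "y \<in> V" "s \<in> {0..T}" for y s
      using m(2)[OF that] z(2)[OF that(1)] by linarith
    have "m z = 0"
    proof (rule ccontr)
      assume "m z \<noteq> 0"
      hence pos: "m z > 0" "m z \<le> T" using m(1)[OF z(1)] by auto
      have "L (\<lambda>y. w y (m z)) z \<le> 0" unfolding laplacian_def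
        using max[OF nbrs_in_V, of _ z "m z"] m(1)[OF z(1)] by (intro sum_nonpos) (auto simp: u_def)
      hence "w' z (m z) - \<epsilon> < 0" using le[OF z(1), of "m z"] pos \<epsilon> by linarith
      moreover have "(u z has_real_derivative w' z (m z) - \<epsilon>) (at (m z))"
        unfolding u_def using pos by (auto intro!: derivative_eq_intros deriv z)
      ultimately obtain \<delta> where \<delta>: "\<delta> > 0" "\<And>h. 0 < h \<Longrightarrow> h < \<delta> \<Longrightarrow> u z (m z) < u z (m z - h)"
        using DERIV_neg_dec_left by blast
      define h where "h = min (\<delta> / 2) (m z)"
      have "0 < h" "h < \<delta>" "m z - h \<in> {0..T}" using pos \<delta>(1) by (auto simp: h_def min_def)
      thus False using \<delta>(2)[of h] max[OF z(1), of "m z - h"] by linarith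
    qed
    thus ?thesis using max[OF x, of T] T init[OF z(1)] by (simp add: u_def)
  qed
  note * = this
  show ?thesis
  proof (rule field_le_epsilon)
    fix e :: real assume e: "e > 0"
    \<comment> \<open>The denominator \<open>T + 1\<close> keeps the choice of
      \<open>\<epsilon>\<close> valid at \<open>T = 0\<close>.\<close>
    have "w x T - e / (T + 1) * T \<le> c" using e T by (intro *) auto
    moreover have "e / (T + 1) * T \<le> e" using e T by (simp add: field_simps)
    ultimately show "w x T \<le> c + e" by linarith
  qed
qed

text \<open>The left side is the time derivative of \<Gamma> along the heat flow.\<close>

lemma Gamma2_diag: "2 * \<Gamma> h (L h) x = L (\<Gamma> h h) x - 2 * \<Gamma>\<^sub>2 h h x"
  unfolding Gamma2 Gamma1_commute[of "L h" h] by (simp add: field_simps)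

text \<open>The function \<open>w\<close> of the overview; the weight compensates the decay rate
  forced by the curvature.\<close>

definition energy :: "real \<Rightarrow> ('a \<Rightarrow> real) \<Rightarrow> real \<Rightarrow> 'a \<Rightarrow> real" where
  "energy K f t x = exp (2 * K * t) * \<Gamma> (heat f t) (heat f t) x"

lemma energy_nonneg: "0 \<le> energy K f t x"
  by (simp add: energy_def Gamma1_nonneg)

lemma energy_deriv:
  assumes "x \<in> V"
  shows "((\<lambda>t. energy K f t x) has_real_derivative
           L (energy K f t) x - 2 * exp (2 * K * t) *
             (\<Gamma>\<^sub>2 (heat f t) (heat f t) x - K * \<Gamma> (heat f t) (heat f t) x)) (at t)"
proof -
  let ?h = "heat f t"
  have *: "L (energy K f t) x = exp (2 * K * t) * L (\<Gamma> ?h ?h) x"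
    by (simp add: laplacian_def energy_def sum_distrib_left right_diff_distrib)
  have "L (energy K f t) x - 2 * exp (2 * K * t) * (\<Gamma>\<^sub>2 ?h ?h x - K * \<Gamma> ?h ?h x) =
      exp (2 * K * t) * (2 * K) * \<Gamma> ?h ?h x + exp (2 * K * t) * (2 * \<Gamma> ?h (L ?h) x)"
    unfolding * Gamma2_diag by (simp add: algebra_simps)
  moreover have "((\<lambda>t. energy K f t x) has_real_derivative
      exp (2 * K * t) * (2 * K) * \<Gamma> ?h ?h x + exp (2 * K * t) * (2 * \<Gamma> ?h (L ?h) x)) (at t)"
    unfolding energy_def by (auto intro!: derivative_eq_intros Gamma_heat_deriv assms)
  ultimately show ?thesis by simp
qed

text \<open>Under the curvature bound the correction term in \<open>energy_deriv\<close> is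
  nonpositive, so the energy is a subsolution starting at \<open>\<Gamma> f f\<close>.\<close>

lemma gradient_estimate:
  assumes CD: "\<And>h x. x \<in> V \<Longrightarrow> K * \<Gamma> h h x \<le> \<Gamma>\<^sub>2 h h x"
    and c: "\<And>x. x \<in> V \<Longrightarrow> \<Gamma> f f x \<le> c" and "x \<in> V" "0 \<le> t"
  shows "energy K f t x \<le> c"
proof (rule parabolic_maximum_principle[of "\<lambda>x t. energy K f t x"])
  show "energy K f 0 x \<le> c" if "x \<in> V" for x using c[OF that] by (simp add: energy_def)
qed (use assms CD in \<open>auto intro!: energy_deriv\<close>)

text \<open>The strong maximum principle: at a vertex where the maximal energy is attained for all
  times, the time derivative vanishes while both terms of the evolution equation are nonpositive.\<close>

lemma energy_constant:
  assumes CD: "\<And>h x. x \<in> V \<Longrightarrow> K * \<Gamma> h h x \<le> \<Gamma>\<^sub>2 h h x"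
    and c: "\<And>x. x \<in> V \<Longrightarrow> \<Gamma> f f x \<le> c"
    and x0: "x0 \<in> V" "\<And>t. 0 \<le> t \<Longrightarrow> energy K f t x0 = c"
    and x: "x \<in> V"
  shows "\<Gamma> f f x = c" "\<Gamma>\<^sub>2 f f x = K * \<Gamma> f f x"
proof -
  have key: "\<forall>z\<in>N y. energy K f t z = c"
      "\<Gamma>\<^sub>2 (heat f t) (heat f t) y = K * \<Gamma> (heat f t) (heat f t) y"
    if y: "y \<in> V" "\<And>t. 0 \<le> t \<Longrightarrow> energy K f t y = c" and t: "0 \<le> t" for y t
  proof -
    let ?D = "\<Gamma>\<^sub>2 (heat f t) (heat f t) y - K * \<Gamma> (heat f t) (heat f t) y"
    have 0: "L (energy K f t) y - 2 * exp (2 * K * t) * ?D = 0"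
      by (rule deriv_eq_0_of_constant[OF energy_deriv y(2) t]) (use y in auto)
    have le: "energy K f t z - energy K f t y \<le> 0" if "z \<in> N y" for z
      using gradient_estimate[OF CD c nbrs_in_V[OF that] t] y(2)[OF t] by simp
    hence 1: "L (energy K f t) y \<le> 0" unfolding laplacian_def by (rule sum_nonpos)
    have 2: "0 \<le> 2 * exp (2 * K * t) * ?D" using CD[OF y(1)] by simp
    from 0 1 2 have "2 * exp (2 * K * t) * ?D = 0" and 3: "L (energy K f t) y = 0" by linarith+
    thus "\<Gamma>\<^sub>2 (heat f t) (heat f t) y = K * \<Gamma> (heat f t) (heat f t) y" by simp
    have "(\<Sum>z\<in>N y. energy K f t y - energy K f t z) = 0"
      using 3 by (simp add: laplacian_def sum_subtractf)
    hence "\<forall>z\<in>N y. energy K f t y - energy K f t z = 0"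
      using le by (subst (asm) sum_nonneg_eq_0_iff) auto
    thus "\<forall>z\<in>N y. energy K f t z = c" using y(2)[OF t] by simp
  qed
  have all: "\<forall>t\<ge>0. energy K f t x = c"
    using x0(1) x
  proof (rule nbrs_induct)
    show "\<forall>t\<ge>0. energy K f t x0 = c" using x0(2) by simp
    show "\<forall>t\<ge>0. energy K f t z = c" if "y \<in> V" "\<forall>t\<ge>0. energy K f t y = c" "z \<in> N y" for y z
      using key(1)[OF that(1)] that(2,3) by blast
  qed
  \<comment> \<open>At time 0 the flow is \<open>f\<close> itself and the weight is 1.\<close>
  from all[rule_format, of 0] show "\<Gamma> f f x = c" by (simp add: energy_def)
  from key(2)[OF x, of 0] all show "\<Gamma>\<^sub>2 f f x = K * \<Gamma> f f x" by simp
qed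

text \<open>By the gradient estimate the increment across each edge decays like
  \<open>exp (- K * t)\<close>; these add up along a path. It makes the flow converge to the
  mean.\<close>

lemma heat_oscillation:
  assumes CD: "\<And>h x. x \<in> V \<Longrightarrow> K * \<Gamma> h h x \<le> \<Gamma>\<^sub>2 h h x"
    and c: "\<And>x. x \<in> V \<Longrightarrow> \<Gamma> f f x \<le> c"
    and "x \<in> V" "y \<in> V"
  shows "\<exists>B. \<forall>t\<ge>0. \<bar>heat f t y - heat f t x\<bar> \<le> B * exp (- K * t)"
  using assms(3,4)
proof (rule nbrs_induct)
  show "\<exists>B. \<forall>t\<ge>0. \<bar>heat f t x - heat f t x\<bar> \<le> B * exp (- K * t)"
    by (rule exI[of _ 0]) simp
next
  fix y z assume y: "y \<in> V" and z: "z \<in> N y"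
    and "\<exists>B. \<forall>t\<ge>0. \<bar>heat f t y - heat f t x\<bar> \<le> B * exp (- K * t)"
  then obtain B where B: "\<And>t. t \<ge> 0 \<Longrightarrow> \<bar>heat f t y - heat f t x\<bar> \<le> B * exp (- K * t)" by blast
  have c0: "0 \<le> c" using c[OF y] Gamma1_nonneg[of f y] by linarith
  have "\<bar>heat f t z - heat f t y\<bar> \<le> sqrt (2 * c) * exp (- K * t)" if t: "t \<ge> 0" for t
  proof -
    have "(heat f t z - heat f t y)\<^sup>2 \<le> (\<Sum>w\<in>N y. (heat f t w - heat f t y)\<^sup>2)"
      using z by (intro member_le_sum) auto
    also have "\<dots> = 2 * \<Gamma> (heat f t) (heat f t) y" by (simp add: Gamma1 power2_eq_square)
    also have "\<dots> \<le> 2 * (c * exp (- 2 * K * t))"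
      using gradient_estimate[OF CD c y t] by (simp add: energy_def exp_minus field_simps)
    also have "\<dots> = (sqrt (2 * c) * exp (- K * t))\<^sup>2"
      using c0 exp_double[of "- K * t"] by (simp add: power_mult_distrib mult.assoc)
    finally have "\<bar>heat f t z - heat f t y\<bar>\<^sup>2 \<le> (sqrt (2 * c) * exp (- K * t))\<^sup>2" by simp
    thus ?thesis by (rule power2_le_imp_le) (use c0 in simp)
  qed
  hence "\<forall>t\<ge>0. \<bar>heat f t z - heat f t x\<bar> \<le> (B + sqrt (2 * c)) * exp (- K * t)"
    using B by (smt (verit, best) distrib_right)
  thus "\<exists>B. \<forall>t\<ge>0. \<bar>heat f t z - heat f t x\<bar> \<le> B * exp (- K * t)" by blast
qed

lemma mean_deviation:
  assumes K: "K > 0"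
    and CD: "\<And>h x. x \<in> V \<Longrightarrow> K * \<Gamma> h h x \<le> \<Gamma>\<^sub>2 h h x"
    and c: "\<And>x. x \<in> V \<Longrightarrow> \<Gamma> f f x \<le> D / 2"
    and x: "x \<in> V" and D: "real (deg V E x) \<le> D"
  defines "m \<equiv> (\<Sum>y\<in>V. f y) / real (card V)"
  shows "m - f x \<le> D / K"
    and "m - f x = D / K \<Longrightarrow> t \<ge> 0 \<Longrightarrow> energy K f t x = D / 2"
proof -
  \<comment> \<open>\<open>g\<close> is nondecreasing and bounded above by a quantity tending to 0,
    hence nonpositive; \<open>g 0 \<le> 0\<close> is the claim.\<close>
  define g where "g = (\<lambda>t. m - heat f t x - D / K * exp (- K * t))"
  have D0: "0 \<le> D" using D by linarith
  have dg: "(g has_real_derivative (D * exp (- K * t) - L (heat f t) x)) (at t)" for t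
    unfolding g_def using K
    by (auto intro!: derivative_eq_intros heat_deriv x)
  have bound: "L (heat f t) x \<le> D * exp (- K * t)" if t: "t \<ge> 0" for t
  proof -
    have "(L (heat f t) x)\<^sup>2 \<le> real (deg V E x) * (2 * \<Gamma> (heat f t) (heat f t) x)"
      by (rule laplacian_sq_le)
    also have "\<dots> \<le> D * (2 * \<Gamma> (heat f t) (heat f t) x)"
      by (intro mult_right_mono D) (simp add: Gamma1_nonneg)
    also have "\<dots> \<le> D * (D * exp (- 2 * K * t))"
      using gradient_estimate[OF CD c x t] D0
      by (intro mult_left_mono) (simp_all add: energy_def exp_minus field_simps)
    also have "\<dots> = (D * exp (- K * t))\<^sup>2"
      using exp_double[of "- K * t"] by (simp add: power2_eq_square mult_ac)
    finally show ?thesis by (rule power2_le_imp_le) (use D0 in simp)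
  qed
  have mono: "g s \<le> g t" if "0 \<le> s" "s \<le> t" for s t
    using that bound dg by (intro DERIV_nonneg_imp_nondecreasing[of s t g]) force+
  have "\<forall>y\<in>V. \<exists>B. \<forall>t\<ge>0. \<bar>heat f t y - heat f t x\<bar> \<le> B * exp (- K * t)"
    using heat_oscillation[OF CD c x] by blast
  then obtain B where B: "\<And>y t. y \<in> V \<Longrightarrow> t \<ge> 0 \<Longrightarrow>
      \<bar>heat f t y - heat f t x\<bar> \<le> B y * exp (- K * t)" by metis
  have n: "real (card V) > 0" using finV V_nonempty by (simp add: card_gt_0_iff)
  have up: "g t \<le> (\<Sum>y\<in>V. B y) / real (card V) * exp (- K * t)" if t: "t \<ge> 0" for t
  proof -
    have "m - heat f t x = (\<Sum>y\<in>V. heat f t y - heat f t x) / real (card V)"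
      using n by (simp add: m_def sum_subtractf sum_heat diff_divide_distrib)
    also have "\<dots> \<le> (\<Sum>y\<in>V. B y * exp (- K * t)) / real (card V)"
      using B[OF _ t] by (intro divide_right_mono sum_mono) (force simp: abs_le_iff)+
    also have "\<dots> = (\<Sum>y\<in>V. B y) / real (card V) * exp (- K * t)"
      by (simp add: sum_distrib_right)
    finally have "m - heat f t x \<le> (\<Sum>y\<in>V. B y) / real (card V) * exp (- K * t)" .
    moreover have "0 \<le> D / K * exp (- K * t)" using D0 K by simp
    ultimately show ?thesis unfolding g_def by linarith
  qed
  have lim: "((\<lambda>t. (\<Sum>y\<in>V. B y) / real (card V) * exp (- K * t)) \<longlongrightarrow> 0) at_top"
    using K by (intro tendsto_mult_right_zero filterlim_compose[OF exp_at_bot]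
        filterlim_tendsto_neg_mult_at_bot[OF tendsto_const] filterlim_ident) simp
  have g_le: "g s \<le> 0" if s: "s \<ge> 0" for s
  proof (rule tendsto_lowerbound[OF lim])
    have "g s \<le> (\<Sum>y\<in>V. B y) / real (card V) * exp (- K * t)" if "s \<le> t" for t
      using mono[OF s that] up[of t] s that by linarith
    thus "\<forall>\<^sub>F t in at_top. g s \<le> (\<Sum>y\<in>V. B y) / real (card V) * exp (- K * t)"
      by (rule eventually_at_top_linorderI)
  qed simp
  from g_le[of 0] show "m - f x \<le> D / K" by (simp add: g_def)
  assume eq: "m - f x = D / K" and t: "t \<ge> 0"
  \<comment> \<open>In the equality case \<open>g\<close> is squeezed between \<open>g 0 = 0\<close>
    and 0, so every estimate on its derivative is an equality.\<close>
  have g0: "g s = 0" if "s \<ge> 0" for s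
    using mono[of 0 s] g_le[OF that] that eq by (simp add: g_def)
  have "D * exp (- K * t) - L (heat f t) x = 0"
    by (rule deriv_eq_0_of_constant[OF dg g0 t])
  hence "(D * exp (- K * t))\<^sup>2 \<le> real (deg V E x) * (2 * \<Gamma> (heat f t) (heat f t) x)"
    using laplacian_sq_le[of "heat f t" x] by simp
  also have "\<dots> \<le> D * (2 * \<Gamma> (heat f t) (heat f t) x)"
    by (intro mult_right_mono D) (simp add: Gamma1_nonneg)
  finally have "D * (D * exp (- K * t) ^ 2) \<le> D * (2 * \<Gamma> (heat f t) (heat f t) x)"
    by (simp add: power_mult_distrib power2_eq_square mult_ac)
  \<comment> \<open>If \<open>D = 0\<close>, the energy is trapped between 0 and
    \<open>D / 2\<close> anyway.\<close>
  hence "D = 0 \<or> D * exp (- K * t) ^ 2 \<le> 2 * \<Gamma> (heat f t) (heat f t) x"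
    using D0 by (auto simp: mult_le_cancel_left)
  moreover have "exp (- K * t) ^ 2 = 1 / exp (2 * K * t)"
    using exp_double[of "- K * t"] exp_minus[of "2 * K * t"] by (simp add: mult.assoc divide_inverse)
  ultimately have "D = 0 \<or> D / exp (2 * K * t) \<le> 2 * \<Gamma> (heat f t) (heat f t) x" by simp
  hence "D = 0 \<or> D \<le> 2 * energy K f t x"
    unfolding energy_def by (simp add: pos_divide_le_eq mult_ac)
  thus "energy K f t x = D / 2"
    using gradient_estimate[OF CD c x t] energy_nonneg[of K f t x] by auto
qed

subsection \<open>Sharpness of the effective diameter bound\<close>

lemma dist_Gamma_le:
  assumes "x \<in> V" "y \<in> V"
  shows "\<Gamma> (\<lambda>z. real (d x z)) (\<lambda>z. real (d x z)) y \<le> real (deg V E y) / 2"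
proof -
  have "(\<Sum>z\<in>N y. (real (d x z) - real (d x y)) * (real (d x z) - real (d x y))) \<le> (\<Sum>z\<in>N y. 1)"
    using dist_nbr[OF assms] by (intro sum_mono) (simp add: power2_eq_square[symmetric] abs_square_le_1)
  thus ?thesis by (simp add: Gamma1 deg_def)
qed

text \<open>Distance is 1-Lipschitz, so equality forces full degree and a change of exactly 1 across
  each edge at \<open>y\<close>.\<close>

lemma dist_Gamma_eq:
  assumes "x \<in> V" "y \<in> V"
    and "\<Gamma> (\<lambda>z. real (d x z)) (\<lambda>z. real (d x z)) y = real (max_deg V E) / 2"
  shows "deg V E y = max_deg V E" and "z \<in> N y \<Longrightarrow> d x z = Suc (d x y) \<or> d x y = Suc (d x z)"
proof -
  show deg: "deg V E y = max_deg V E"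
    using dist_Gamma_le[OF assms(1,2)] assms(3) deg_le_max_deg[OF assms(2)] by linarith
  assume z: "z \<in> N y"
  have "(\<Sum>z\<in>N y. 1 - (real (d x z) - real (d x y))\<^sup>2) = 0"
    using assms(3) deg by (simp add: Gamma1 deg_def sum_subtractf power2_eq_square)
  hence "1 - (real (d x z) - real (d x y))\<^sup>2 = 0"
    using dist_nbr[OF assms(1,2)] z by (subst (asm) sum_nonneg_eq_0_iff) (auto simp: abs_square_le_1)
  hence "real (d x z) - real (d x y) = 1 \<or> real (d x z) - real (d x y) = - 1"
    by (simp add: power2_eq_1_iff)
  thus "d x z = Suc (d x y) \<or> d x y = Suc (d x z)" by linarith
qed

lemma sharp_diam_eff:
  assumes K: "K > 0"
    and CD: "\<And>h x. x \<in> V \<Longrightarrow> K * \<Gamma> h h x \<le> \<Gamma>\<^sub>2 h h x"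
    and sharp: "diam_eff V E = real (max_deg V E) / K"
    and x: "x \<in> V" and y: "y \<in> V"
  shows "\<Gamma> (\<lambda>z. real (d x z)) (\<lambda>z. real (d x z)) y = real (max_deg V E) / 2"
    and "\<Gamma>\<^sub>2 (\<lambda>z. real (d x z)) (\<lambda>z. real (d x z)) y = K * \<Gamma> (\<lambda>z. real (d x z)) (\<lambda>z. real (d x z)) y"
proof -
  let ?D = "real (max_deg V E)" and ?n = "real (card V)"
  have c: "\<Gamma> (\<lambda>z. real (d x z)) (\<lambda>z. real (d x z)) y \<le> ?D / 2" if "x \<in> V" "y \<in> V" for x y
    using dist_Gamma_le[OF that] deg_le_max_deg[OF that(2)] by linarith
  have D: "real (deg V E x) \<le> ?D" if "x \<in> V" for x using deg_le_max_deg[OF that] by simp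
  have le: "(\<Sum>z\<in>V. real (d x z)) / ?n \<le> ?D / K" if "x \<in> V" for x
    using mean_deviation(1)[OF K CD c[OF that] that D[OF that]] by simp
  have n: "?n > 0" using finV V_nonempty by (simp add: card_gt_0_iff)
  \<comment> \<open>The effective diameter averages the mean distances from each vertex; these are
    all at most \<open>?D / K\<close>, so a sharp average makes each of them sharp.\<close>
  have "(\<Sum>x\<in>V. ?D / K - (\<Sum>z\<in>V. real (d x z)) / ?n) = ?n * (?D / K) - ?n * diam_eff V E"
    using n by (simp add: sum_subtractf diam_eff_def sum_divide_distrib[symmetric] power2_eq_square)
  also have "\<dots> = 0" by (simp add: sharp)
  finally have "?D / K - (\<Sum>z\<in>V. real (d x z)) / ?n = 0"
    using le x finV by (subst (asm) sum_nonneg_eq_0_iff) auto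
  hence energy: "energy K (\<lambda>z. real (d x z)) t x = ?D / 2" if "t \<ge> 0" for t
    using mean_deviation(2)[OF K CD c[OF x] x D[OF x] _ that] by simp
  show "\<Gamma> (\<lambda>z. real (d x z)) (\<lambda>z. real (d x z)) y = ?D / 2"
    "\<Gamma>\<^sub>2 (\<lambda>z. real (d x z)) (\<lambda>z. real (d x z)) y = K * \<Gamma> (\<lambda>z. real (d x z)) (\<lambda>z. real (d x z)) y"
    using energy_constant[OF CD c[OF x] x energy y] by blast+
qed

section \<open>Equality in the curvature inequality\<close>

text \<open>A null vector of a positive semidefinite form lies in its radical.\<close>

lemma Gamma2_polarize:
  assumes CD: "\<And>h. K * \<Gamma> h h y \<le> \<Gamma>\<^sub>2 h h y"
    and f: "\<Gamma>\<^sub>2 f f y = K * \<Gamma> f f y"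
  shows "\<Gamma>\<^sub>2 f g y = K * \<Gamma> f g y"
proof -
  have "2 * (\<Gamma>\<^sub>2 f g y - K * \<Gamma> f g y) = 0"
  proof (rule quadratic_nonneg_imp_linear_zero)
    fix s
    show "0 \<le> s * (2 * (\<Gamma>\<^sub>2 f g y - K * \<Gamma> f g y)) + s\<^sup>2 * (\<Gamma>\<^sub>2 g g y - K * \<Gamma> g g y)"
      using CD[of "\<lambda>z. 1 * f z + s * g z"] f
      unfolding Gamma1_quadratic Gamma2_quadratic by (simp add: algebra_simps)
  qed
  thus ?thesis by simp
qed

lemma Gamma2_indicator:
  assumes y: "y \<in> V" and z: "z \<in> V" "z \<noteq> y" "z \<notin> N y"
  defines "g \<equiv> (\<lambda>w. if w = z then 1 else 0)"
  shows "\<Gamma> f g y = 0"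
    and "4 * \<Gamma>\<^sub>2 f g y = (\<Sum>w\<in>N y \<inter> N z. f z + f y - 2 * f w)"
proof -
  \<comment> \<open>As \<open>g\<close> vanishes on the closed neighbourhood of \<open>y\<close>,
    only two-step walks from \<open>y\<close> to \<open>z\<close> contribute below.\<close>
  have g0: "g w = 0" if "w = y \<or> w \<in> N y" for w using z that by (auto simp: g_def)
  show G0: "\<Gamma> h g y = 0" for h by (simp add: Gamma1 g0)
  have Lg0: "L g y = 0" by (simp add: laplacian_def g0)
  have G: "2 * \<Gamma> f g w = (if w \<in> N z then f z - f w else 0)" if w: "w \<in> N y" for w
  proof -
    have wV: "w \<in> V" by (rule nbrs_in_V[OF w])
    have "2 * \<Gamma> f g w = (\<Sum>v\<in>N w. (f v - f w) * g v)"
      unfolding Gamma1 using g0[of w] w by simp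
    also have "\<dots> = (\<Sum>v\<in>N w. if v = z then f v - f w else 0)"
      by (intro sum.cong) (auto simp: g_def)
    also have "\<dots> = (if z \<in> N w then f z - f w else 0)" by simp
    also have "z \<in> N w \<longleftrightarrow> w \<in> N z" using nbrs_sym wV z(1) by blast
    finally show ?thesis .
  qed
  have Lg: "L g w = (if w \<in> N z then 1 else 0)" if w: "w \<in> N y" for w
  proof -
    have wV: "w \<in> V" by (rule nbrs_in_V[OF w])
    have "L g w = (\<Sum>v\<in>N w. if v = z then 1 else 0)"
      unfolding laplacian_def using g0[of w] w by (simp add: g_def)
    also have "\<dots> = (if z \<in> N w then 1 else 0)" by simp
    also have "z \<in> N w \<longleftrightarrow> w \<in> N z" using nbrs_sym wV z(1) by blast
    finally show ?thesis .
  qed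
  have "2 * L (\<Gamma> f g) y = (\<Sum>w\<in>N y. if w \<in> N z then f z - f w else 0)"
    unfolding laplacian_def by (simp add: G0 sum_distrib_left G)
  hence 1: "2 * L (\<Gamma> f g) y = (\<Sum>w\<in>N y \<inter> N z. f z - f w)"
    by (simp add: sum.inter_restrict)
  have "2 * \<Gamma> f (L g) y = (\<Sum>w\<in>N y. if w \<in> N z then f w - f y else 0)"
    unfolding Gamma1 by (simp add: Lg0 Lg) (intro sum.cong refl, auto)
  hence 2: "2 * \<Gamma> f (L g) y = (\<Sum>w\<in>N y \<inter> N z. f w - f y)"
    by (simp add: sum.inter_restrict)
  have "4 * \<Gamma>\<^sub>2 f g y = 2 * L (\<Gamma> f g) y - 2 * \<Gamma> f (L g) y"
    unfolding Gamma2 G0[of "L f"] by simp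
  thus "4 * \<Gamma>\<^sub>2 f g y = (\<Sum>w\<in>N y \<inter> N z. f z + f y - 2 * f w)"
    unfolding 1 2 sum_subtractf[symmetric] by (simp add: algebra_simps)
qed

end

subsection \<open>Coordinates from edge splittings\<close>

text \<open>The combinatorial content of sharpness: \<open>reg\<close> and \<open>bip\<close> come
  from the equality for \<Gamma>, \<open>affine\<close> from the one for
  \<open>\<Gamma>\<^sub>2\<close>.\<close>

locale sharp_graph = finite_graph +
  fixes n :: nat
  assumes reg: "y \<in> V \<Longrightarrow> card (N y) = n"
    and bip: "x \<in> V \<Longrightarrow> y \<in> V \<Longrightarrow> z \<in> N y \<Longrightarrow> d x z = Suc (d x y) \<or> d x y = Suc (d x z)"
    and affine: "x \<in> V \<Longrightarrow> y \<in> V \<Longrightarrow> z \<in> V \<Longrightarrow> z \<noteq> y \<Longrightarrow> z \<notin> N y \<Longrightarrow>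
      (\<Sum>w\<in>N y \<inter> N z. real (d x z) + real (d x y) - 2 * real (d x w)) = 0"
begin

lemma dist_nbrs_of_common:
  assumes "x \<in> V" "y \<in> N x" "z \<in> N x" "y \<noteq> z"
  shows "d y z = 2"
proof -
  have V: "y \<in> V" "z \<in> V" using assms nbrs_in_V by auto
  have "d y x = 1" using assms V dist_eq_1 dist_sym by metis
  hence "d y z = 2 \<or> d y z = 0" using bip[of y x z] assms V by auto
  thus ?thesis using dist_eq_0 V assms by blast
qed

lemma triangle_free: "x \<in> V \<Longrightarrow> y \<in> N x \<Longrightarrow> z \<in> N x \<Longrightarrow> z \<notin> N y"
  using dist_nbrs_of_common dist_eq_1 nbrs_in_V not_self_nbr by (metis one_eq_numeral_iff semiring_norm(83))

lemma card_common_nbrs: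
  assumes y: "y \<in> V" and z: "z \<in> V" "z \<noteq> y" "z \<notin> N y" and x: "x \<in> N y" "x \<in> N z"
  shows "card (N y \<inter> N z) = 2"
proof -
  let ?C = "N y \<inter> N z"
  have xV: "x \<in> V" using x nbrs_in_V by blast
  have d1: "d x y = 1" "d x z = 1" using x xV y z dist_eq_1 nbrs_sym by metis+
  have d2: "d x w = 2" if "w \<in> ?C - {x}" for w using dist_nbrs_of_common[OF y, of x w] x that by auto
  have "0 = (\<Sum>w\<in>?C. real (d x z) + real (d x y) - 2 * real (d x w))"
    using affine[OF xV y z] by simp
  also have "\<dots> = (\<Sum>w\<in>?C. 2 - 2 * real (d x w))" by (simp add: d1)
  \<comment> \<open>\<open>x\<close> contributes 2 and every other common neighbour, at distance 2
    from \<open>x\<close>, contributes -2; so there is exactly one other.\<close>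
  also have "\<dots> = 2 + (\<Sum>w\<in>?C - {x}. 2 - 2 * real (d x w))"
    using x by (subst sum.remove[of _ x]) auto
  also have "(\<Sum>w\<in>?C - {x}. 2 - 2 * real (d x w)) = (\<Sum>w\<in>?C - {x}. - 2)"
    using d2 by (intro sum.cong) auto
  also have "\<dots> = - 2 * real (card (?C - {x}))" by simp
  finally have "card (?C - {x}) = 1" by simp
  thus ?thesis using x by (simp add: card_Diff_singleton_if)
qed

lemma square:
  assumes a: "a \<in> V" and b: "b \<in> N a" and a': "a' \<in> N a" and ne: "a' \<noteq> b"
  obtains b' where "b' \<in> N a'" "\<And>v. v \<in> V \<Longrightarrow> d a v + d b' v = d b v + d a' v"
proof -
  have V: "b \<in> V" "a' \<in> V" using b a' nbrs_in_V by auto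
  have nb: "a' \<notin> N b" by (rule triangle_free[OF a b a'])
  have aC: "a \<in> N b \<inter> N a'" using nbrs_sym a b a' by blast
  have "card (N b \<inter> N a') = 2" using card_common_nbrs[OF V(1) V(2) ne nb] aC by blast
  then obtain b' where C: "N b \<inter> N a' = {a, b'}" "b' \<noteq> a"
    using aC by (metis card_2_iff doubleton_eq_iff insertE singletonD)
  show ?thesis
  proof
    show "b' \<in> N a'" using C by auto
    fix v assume v: "v \<in> V"
    show "d a v + d b' v = d b v + d a' v"
      using affine[OF v V ne nb] C(2) dist_sym[of v] unfolding C(1) by simp
  qed
qed

text \<open>The edge \<open>ab\<close> splits \<open>V\<close> into the vertices closer to \<open>a\<close> and those closer to \<open>b\<close>;
  opposite edges of a square induce the same splitting.\<close>

definition sep :: "'a \<Rightarrow> 'a \<Rightarrow> 'a \<Rightarrow> 'a \<Rightarrow> bool" where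
  "sep a b u v \<longleftrightarrow> (d b u < d a u) \<noteq> (d b v < d a v)"

text \<open>A neighbour of \<open>a\<close> other than \<open>b\<close> has distance 2 from
  \<open>b\<close>, so it stays on the side of \<open>a\<close>. Hence distinct edges at
  \<open>a\<close> have distinct splittings.\<close>

lemma sep_edge:
  assumes a: "a \<in> V" and b: "b \<in> N a" "c \<in> N a"
  shows "sep a b a c \<longleftrightarrow> b = c"
proof -
  have "d a c = 1" using dist_eq_1 a b nbrs_in_V by blast
  thus ?thesis using dist_nbrs_of_common[OF a b] by (cases "b = c") (auto simp: sep_def)
qed

lemma sep_geodesic: "Suc (d z v) = d u v \<Longrightarrow> sep u z u v"
  by (simp add: sep_def)

lemma sep_step:
  assumes a: "a \<in> V" and b: "b \<in> N a" and a': "a' \<in> N a"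
  shows "\<exists>b'\<in>N a'. \<forall>u\<in>V. \<forall>v\<in>V. sep a' b' u v = sep a b u v"
proof (cases "a' = b")
  case True
  \<comment> \<open>Reversing the edge swaps its sides; \<open>bip\<close> rules out ties, so
    separation is unchanged.\<close>
  have "(d a u < d b u) = (\<not> d b u < d a u)" if "u \<in> V" for u
    using bip[OF that a b] dist_sym[of u] by auto
  hence "\<forall>u\<in>V. \<forall>v\<in>V. sep a' a u v = sep a b u v" by (simp add: sep_def True)
  thus ?thesis using nbrs_sym[OF a a'] by blast
next
  case False
  obtain b' where b': "b' \<in> N a'" "\<And>v. v \<in> V \<Longrightarrow> d a v + d b' v = d b v + d a' v"
    using square[OF a b a' False] by blast
  have "(d b' v < d a' v) = (d b v < d a v)" if "v \<in> V" for v
    using b'(2)[OF that] by linarith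
  hence "\<forall>u\<in>V. \<forall>v\<in>V. sep a' b' u v = sep a b u v" by (simp add: sep_def)
  thus ?thesis using b'(1) by blast
qed

lemma sep_transport:
  assumes x: "x \<in> V" and v: "v \<in> V"
  obtains \<tau> where "bij_betw \<tau> (N x) (N v)"
    and "\<And>b u w. b \<in> N x \<Longrightarrow> u \<in> V \<Longrightarrow> w \<in> V \<Longrightarrow> sep v (\<tau> b) u w = sep x b u w"
proof -
  have "\<forall>b\<in>N x. \<exists>b'\<in>N v. \<forall>u\<in>V. \<forall>w\<in>V. sep v b' u w = sep x b u w"
    using x v
  proof (rule nbrs_induct)
    fix y z assume "y \<in> V" "\<forall>b\<in>N x. \<exists>b'\<in>N y. \<forall>u\<in>V. \<forall>w\<in>V. sep y b' u w = sep x b u w" "z \<in> N y"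
    thus "\<forall>b\<in>N x. \<exists>b'\<in>N z. \<forall>u\<in>V. \<forall>w\<in>V. sep z b' u w = sep x b u w"
      using sep_step[of y _ z] by metis
  qed blast
  then obtain \<tau> where \<tau>: "\<And>b. b \<in> N x \<Longrightarrow> \<tau> b \<in> N v"
      "\<And>b u w. b \<in> N x \<Longrightarrow> u \<in> V \<Longrightarrow> w \<in> V \<Longrightarrow> sep v (\<tau> b) u w = sep x b u w" by metis
  have inj: "inj_on \<tau> (N x)"
  proof (rule inj_onI)
    fix b c assume "b \<in> N x" "c \<in> N x" "\<tau> b = \<tau> c"
    \<comment> \<open>The common splitting separates \<open>x\<close> from \<open>b\<close>, which
      only the edge to \<open>b\<close> does.\<close>
    thus "b = c" using \<tau>(2)[of b x b] \<tau>(2)[of c x b] sep_edge[OF x] x nbrs_in_V by metis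
  qed
  have "\<tau> ` N x = N v"
    \<comment> \<open>Regularity upgrades the injection to a bijection.\<close>
    using inj \<tau>(1) reg[OF x] reg[OF v] by (intro card_subset_eq) (auto simp: card_image)
  thus ?thesis using that \<tau>(2) inj by (auto simp: bij_betw_def)
qed

lemma is_hypercube: "is_hypercube V E"
proof -
  obtain x where x: "x \<in> V" using V_nonempty by blast
  obtain e where e: "bij_betw e {..<n} (N x)"
    using ex_bij_betw_nat_finite[of "N x"] reg[OF x] by (auto simp: atLeast0LessThan)
  \<comment> \<open>Bit \<open>i\<close> records the side of the splitting by the edge from
    \<open>x\<close> to \<open>e i\<close>.\<close>
  define \<phi> where "\<phi> v = map (\<lambda>i. d (e i) v < d x v) [0..<n]" for v
  have len: "length (\<phi> v) = n" for v by (simp add: \<phi>_def)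
  have nbr_flips: "\<exists>\<sigma>. bij_betw \<sigma> {..<n} (N v) \<and>
      (\<forall>i<n. \<forall>u\<in>V. \<forall>w\<in>V. sep v (\<sigma> i) u w \<longleftrightarrow> \<phi> u ! i \<noteq> \<phi> w ! i)" if v: "v \<in> V" for v
  proof -
    obtain \<tau> where \<tau>: "bij_betw \<tau> (N x) (N v)"
      "\<And>b u w. b \<in> N x \<Longrightarrow> u \<in> V \<Longrightarrow> w \<in> V \<Longrightarrow> sep v (\<tau> b) u w = sep x b u w"
      using sep_transport[OF x v] by blast
    have "sep v ((\<tau> \<circ> e) i) u w \<longleftrightarrow> \<phi> u ! i \<noteq> \<phi> w ! i" if "i < n" "u \<in> V" "w \<in> V" for i u w
    proof -
      have "e i \<in> N x" using e that(1) by (auto simp: bij_betw_def)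
      thus ?thesis using \<tau>(2) that by (simp add: \<phi>_def sep_def)
    qed
    thus ?thesis using bij_betw_trans[OF e \<tau>(1)] by blast
  qed
  have flip: "\<exists>\<sigma>. bij_betw \<sigma> {..<n} (N v) \<and>
      (\<forall>i<n. \<forall>j<n. \<phi> v ! j \<noteq> \<phi> (\<sigma> i) ! j \<longleftrightarrow> j = i)" if v: "v \<in> V" for v
  proof -
    obtain \<sigma> where \<sigma>: "bij_betw \<sigma> {..<n} (N v)"
      "\<And>i u w. i < n \<Longrightarrow> u \<in> V \<Longrightarrow> w \<in> V \<Longrightarrow> sep v (\<sigma> i) u w \<longleftrightarrow> \<phi> u ! i \<noteq> \<phi> w ! i"
      using nbr_flips[OF v] by metis
    have "\<phi> v ! j \<noteq> \<phi> (\<sigma> i) ! j \<longleftrightarrow> j = i" if "i < n" "j < n" for i j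
    proof -
      have N: "\<sigma> i \<in> N v" "\<sigma> j \<in> N v" using \<sigma>(1) that by (auto simp: bij_betw_def)
      have "\<phi> v ! j \<noteq> \<phi> (\<sigma> i) ! j \<longleftrightarrow> \<sigma> j = \<sigma> i"
        using \<sigma>(2)[OF that(2) v nbrs_in_V[OF N(1)]] sep_edge[OF v N(2,1)] by blast
      thus ?thesis using \<sigma>(1) that by (auto simp: bij_betw_def inj_on_def)
    qed
    thus ?thesis using \<sigma>(1) by blast
  qed
  have inj: "inj_on \<phi> V"
  \<comment> \<open>The first edge of a geodesic separates its endpoints, and its splitting is one
    of the coordinates.\<close>
  proof (rule inj_onI, rule ccontr)
    fix u v assume u: "u \<in> V" and v: "v \<in> V" and eq: "\<phi> u = \<phi> v" and "u \<noteq> v"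
    then obtain z where z: "z \<in> N u" "Suc (d z v) = d u v" using geodesic_step by blast
    obtain \<sigma> where \<sigma>: "bij_betw \<sigma> {..<n} (N u)"
      "\<And>i v w. i < n \<Longrightarrow> v \<in> V \<Longrightarrow> w \<in> V \<Longrightarrow> sep u (\<sigma> i) v w \<longleftrightarrow> \<phi> v ! i \<noteq> \<phi> w ! i"
      using nbr_flips[OF u] by metis
    obtain i where i: "i < n" "z = \<sigma> i" using z(1) \<sigma>(1) by (auto simp: bij_betw_def)
    thus False using \<sigma>(2)[OF i(1) u v] sep_geodesic[OF z(2)] eq by simp
  qed
  have surj: "xs \<in> \<phi> ` V" if xs: "length xs = n" for xs
  proof -
    have "xs \<in> \<phi> ` V" if "v \<in> V" for v
      using that
    \<comment> \<open>Induction on the Hamming distance to \<open>xs\<close>: moving to a suitable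
      neighbour corrects one wrong bit.\<close>
    proof (induction "card {i. i < n \<and> \<phi> v ! i \<noteq> xs ! i}" arbitrary: v rule: less_induct)
      case less
      show ?case
      proof (cases "\<forall>i<n. \<phi> v ! i = xs ! i")
        case True
        hence "\<phi> v = xs" using xs len by (intro nth_equalityI) auto
        thus ?thesis using less.prems by blast
      next
        case False
        then obtain i where i: "i < n" "\<phi> v ! i \<noteq> xs ! i" by blast
        then obtain w where w: "w \<in> N v" "\<And>j. j < n \<Longrightarrow> \<phi> v ! j \<noteq> \<phi> w ! j \<longleftrightarrow> j = i"
          using flip[OF less.prems] bij_betw_apply lessThan_iff by metis
        have "{j. j < n \<and> \<phi> w ! j \<noteq> xs ! j} \<subset> {j. j < n \<and> \<phi> v ! j \<noteq> xs ! j}"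
          using w(2) i by blast
        hence "card {j. j < n \<and> \<phi> w ! j \<noteq> xs ! j} < card {j. j < n \<and> \<phi> v ! j \<noteq> xs ! j}"
          by (intro psubset_card_mono) auto
        thus ?thesis using less.hyps nbrs_in_V[OF w(1)] by blast
      qed
    qed
    thus ?thesis using x by blast
  qed
  have adj: "E u v \<longleftrightarrow> hc_adj n (\<phi> u) (\<phi> v)" if u: "u \<in> V" and v: "v \<in> V" for u v
  proof
    assume "E u v"
    hence vN: "v \<in> N u" using v by (simp add: nbrs_def)
    obtain \<sigma> where \<sigma>: "bij_betw \<sigma> {..<n} (N u)"
      "\<And>i j. i < n \<Longrightarrow> j < n \<Longrightarrow> \<phi> u ! j \<noteq> \<phi> (\<sigma> i) ! j \<longleftrightarrow> j = i" using flip[OF u] by metis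
    have "v \<in> \<sigma> ` {..<n}" using vN \<sigma>(1) by (simp add: bij_betw_def)
    then obtain i where "i < n" "v = \<sigma> i" by auto
    hence "i < n" "\<And>j. j < n \<Longrightarrow> \<phi> u ! j \<noteq> \<phi> v ! j \<longleftrightarrow> j = i" using \<sigma>(2) by auto
    hence "{j. j < n \<and> \<phi> u ! j \<noteq> \<phi> v ! j} = {i}" by blast
    thus "hc_adj n (\<phi> u) (\<phi> v)" by (simp add: hc_adj_def)
  next
    assume "hc_adj n (\<phi> u) (\<phi> v)"
    then obtain i where i: "{j. j < n \<and> \<phi> u ! j \<noteq> \<phi> v ! j} = {i}"
      by (auto simp: hc_adj_def card_1_singleton_iff)
    hence "i < n" by blast
    then obtain w where w: "w \<in> N u" "\<And>j. j < n \<Longrightarrow> \<phi> u ! j \<noteq> \<phi> w ! j \<longleftrightarrow> j = i"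
      using flip[OF u] bij_betw_apply lessThan_iff by metis
    \<comment> \<open>The neighbour \<open>w\<close> flips the same single bit as \<open>v\<close>,
      so injectivity identifies them.\<close>
    have "\<phi> w ! j = \<phi> v ! j" if "j < n" for j using w(2)[OF that] i that by blast
    hence "\<phi> w = \<phi> v" using len by (intro nth_equalityI) auto
    hence "w = v" using inj nbrs_in_V[OF w(1)] v by (auto simp: inj_on_def)
    thus "E u v" using w(1) by (simp add: nbrs_def)
  qed
  have "bij_betw \<phi> V {xs. length xs = n}" using inj surj len by (auto simp: bij_betw_def)
  thus ?thesis using adj unfolding is_hypercube_def by blast
qed

end

theorem theoremA2:
  fixes V :: "'a set" and E :: "'a \<Rightarrow> 'a \<Rightarrow> bool" and K :: real
  assumes "simple_graph V E"
    and "connected_graph V E"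
    and "K > 0"
    and "\<forall>x\<in>V. ereal K \<le> BE_curv V E x"
    and "diam_eff V E = real (max_deg V E) / K"
  shows "is_hypercube V E"
proof -
  interpret finite_graph V E by unfold_locales fact+
  have CD: "K * \<Gamma> h h x \<le> \<Gamma>\<^sub>2 h h x" if "x \<in> V" for h x
    using curvature_dimension assms(4) that by blast
  note sharp = sharp_diam_eff[OF assms(3) CD assms(5)]
  interpret sharp_graph V E "max_deg V E"
  proof
    fix x y z assume x: "x \<in> V" and y: "y \<in> V"
    show "z \<in> N y \<Longrightarrow> d x z = Suc (d x y) \<or> d x y = Suc (d x z)"
      using dist_Gamma_eq(2)[OF x y] sharp(1) x y by blast
    assume z: "z \<in> V" "z \<noteq> y" "z \<notin> N y"
    show "(\<Sum>w\<in>N y \<inter> N z. real (d x z) + real (d x y) - 2 * real (d x w)) = 0"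
      \<comment> \<open>\<Gamma> of the distance and the indicator vanishes at \<open>y\<close>,
        hence so does \<open>\<Gamma>\<^sub>2\<close>.\<close>
      using Gamma2_indicator[OF y z, of "\<lambda>w. real (d x w)"]
        Gamma2_polarize[OF CD sharp(2), OF y _ x y, of "\<lambda>w. if w = z then 1 else 0"]
      by simp
  next
    fix y assume y: "y \<in> V"
    show "card (N y) = max_deg V E"
      using dist_Gamma_eq(1)[OF y y] sharp(1) y by (simp add: deg_def)
  qed
  show ?thesis by (rule is_hypercube)
qed

end
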